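(* Let $n\ge 2$ and let $u,v$ be vertices of the Lucas cube $\Lambda_n$ with $d(u,v)=\operatorname{diam}(\Lambda_n)$. Then the number of shortest paths from $u$ to $v$ in $\Lambda_n$ equals $\frac{n}{2}E_{n-1}$ if $n$ is even, and $E_{n-1}$ if $n$ is odd, where $E_m$ denotes the $m$th Euler number.
   Context: For $n\ge1$, the hypercube $Q_n$ has vertex set $B_n=\{b_1\cdots b_n: b_i\in\{0,1\}\}$, two strings adjacent iff they differ in exactly one coordinate. The Lucas cube $\Lambda_n$ is the subgraph of $Q_n$ induced by the binary strings $b_1\cdots b_n$ with $b_ib_{i+1}=0$ for all $i\in\{1,\dots,n-1\}$ and additionally $b_1b_n=0$. $d(u,v)$ is the graph distance in $\Lambda_n$ and $\operatorname{diam}(\Lambda_n)$ its diameter. A permutation $\sigma_1\cdots\sigma_m$ of $\{1,\dots,m\}$ is alternating if $\sigma_1>\sigma_2<\sigma_3>\sigma_4<\cdots$; the Euler number $E_m$ is the number of alternating permutations of $\{1,\dots,m\}$ (with $E_0=1$), so $E_1=1,E_2=1,E_3=2,E_4=5,E_5=16$; equivalently $\sum_{m\ge0}E_mx^m/m!=\sec x+\tan x$. *)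

theory Defs
  imports
    "Graph_Theory.Digraph_Component"
    "Graph_Theory.Shortest_Path"
    "HOL-Combinatorics.Permutations"
begin

text \<open>
  A string \<open>b\<^sub>1 \<dots> b\<^sub>n\<close> is a list, with \<open>b\<^sub>i\<close> stored at index \<open>i - 1\<close>.
  Undirected graphs are symmetric loop-free digraphs without parallel arcs
  (locale \<^locale>\<open>graph\<close>), an edge being a pair of opposite arcs.
\<close>

definition binary_strings :: "nat \<Rightarrow> nat list set" where
  "binary_strings n = {b. length b = n \<and> set b \<subseteq> {0, 1}}"

definition hypercube :: "nat \<Rightarrow> (nat list, nat list \<times> nat list) pre_digraph" where
  "hypercube n =
    \<lparr> verts = binary_strings n,
      arcs = {(b, c). b \<in> binary_strings n \<and> c \<in> binary_strings n \<and>
                      card {i. i < n \<and> b ! i \<noteq> c ! i} = 1},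
      tail = fst,
      head = snd \<rparr>"

definition lucas_strings :: "nat \<Rightarrow> nat list set" where
  "lucas_strings n =
    {b \<in> binary_strings n.
       (\<forall>i. i + 1 < n \<longrightarrow> b ! i * b ! (i + 1) = 0) \<and> b ! 0 * b ! (n - 1) = 0}"

definition lucas_cube :: "nat \<Rightarrow> (nat list, nat list \<times> nat list) pre_digraph" where
  "lucas_cube n = hypercube n \<restriction> lucas_strings n"

definition graph_dist :: "('a, 'b) pre_digraph \<Rightarrow> 'a \<Rightarrow> 'a \<Rightarrow> ereal" where
  "graph_dist G u v = wf_digraph.\<mu> G (\<lambda>_. 1) u v"

definition graph_diam :: "('a, 'b) pre_digraph \<Rightarrow> ereal" where
  "graph_diam G = (SUP u \<in> verts G. SUP v \<in> verts G. graph_dist G u v)"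

definition shortest_paths :: "('a, 'b) pre_digraph \<Rightarrow> 'a \<Rightarrow> 'a \<Rightarrow> 'b awalk set" where
  "shortest_paths G u v =
    {p. pre_digraph.apath G u p v \<and> ereal (real (length p)) = graph_dist G u v}"

definition alternating :: "nat \<Rightarrow> (nat \<Rightarrow> nat) \<Rightarrow> bool" where
  "alternating m \<sigma> \<longleftrightarrow>
    (\<forall>i \<in> {1..<m}. if odd i then \<sigma> i > \<sigma> (i + 1) else \<sigma> i < \<sigma> (i + 1))"

definition euler_number :: "nat \<Rightarrow> nat" where
  "euler_number m = card {\<sigma>. \<sigma> permutes {1..m} \<and> alternating m \<sigma>}"

lemma finite_binary_strings: "finite (binary_strings n)"
proof -
  have "binary_strings n = {b. set b \<subseteq> {0, 1} \<and> length b = n}"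
    by (auto simp: binary_strings_def)
  then show ?thesis
    by (simp add: finite_lists_length_eq)
qed

lemma graph_hypercube: "graph (hypercube n)"
proof
  have "arcs (hypercube n) \<subseteq> binary_strings n \<times> binary_strings n"
    by (auto simp: hypercube_def)
  then show "finite (arcs (hypercube n))"
    by (rule finite_subset) (simp add: finite_binary_strings)
  have "{i. i < n \<and> b ! i \<noteq> c ! i} = {i. i < n \<and> c ! i \<noteq> b ! i}" for b c :: "nat list"
    by auto
  then show "symmetric (hypercube n)"
    by (auto simp: symmetric_def hypercube_def arcs_ends_def arc_to_ends_def sym_def image_iff)
qed (auto simp: hypercube_def finite_binary_strings arc_to_ends_def)

lemma graph_lucas_cube: "graph (lucas_cube n)"
proof -
  interpret graph "hypercube n"
    by (rule graph_hypercube)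
  have "lucas_strings n \<subseteq> verts (hypercube n)"
    by (auto simp: lucas_strings_def hypercube_def)
  then have ind: "induced_subgraph (lucas_cube n) (hypercube n)"
    unfolding lucas_cube_def by (rule induced_induce)
  have "digraph (lucas_cube n)"
    by (rule digraphI_induced[OF ind])
  moreover have "sym_digraph (lucas_cube n)"
    by (rule induced_graph_imp_graph[OF ind])
  ultimately show ?thesis
    by (intro graph.intro pseudo_graph.intro) (simp_all add: digraph_def)
qed

lemma graph_dist_eq_INF_length:
  assumes "wf_digraph G"
  shows "graph_dist G u v =
    (INF p \<in> {p. pre_digraph.awalk G u p v}. ereal (real (length p)))"
proof -
  interpret wf_digraph G
    by (rule assms)
  have "awalk_cost (\<lambda>_. 1) p = real (length p)" for p
    by (simp add: awalk_cost_def sum_list_triv)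
  then show ?thesis
    by (simp add: graph_dist_def \<mu>_def)
qed

end

theory Submission
  imports Defs
begin

text \<open>
  A shortest path from \<open>u\<close> to \<open>v\<close> flips every coordinate where \<open>u\<close> and \<open>v\<close> differ exactly once,
  and it stays inside the Lucas cube iff for cyclically adjacent coordinates a change
  \<open>1 \<rightarrow> 0\<close> is made before a change \<open>0 \<rightarrow> 1\<close>. For diametral \<open>u\<close>, \<open>v\<close> the coordinates that change
  are all of \<open>\<int>/n\<close> (\<open>n\<close> even) or all but one (\<open>n\<close> odd), and the two kinds of change alternate
  around the cycle. If \<open>n\<close> is odd, the times of the flips thus form an alternating permutation
  of the remaining path on \<open>n - 1\<close> vertices. If \<open>n\<close> is even, the first flip is one of \<open>n / 2\<close>
  changes \<open>1 \<rightarrow> 0\<close>; it imposes no further restriction, and removing it cuts the cycle into such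
  a path.
\<close>

subsection \<open>Orders of flips\<close>

definition cyc_adj :: "nat \<Rightarrow> nat \<Rightarrow> nat \<Rightarrow> bool" where
  "cyc_adj n i j \<longleftrightarrow> j = Suc i mod n \<or> i = Suc j mod n"

definition before :: "'a list \<Rightarrow> 'a \<Rightarrow> 'a \<Rightarrow> bool" where
  "before xs x y \<longleftrightarrow> (\<exists>a b. a < b \<and> b < length xs \<and> xs ! a = x \<and> xs ! b = y)"

text \<open>In use, \<open>A\<close> are the coordinates to be changed \<open>1 \<rightarrow> 0\<close> and \<open>B\<close> those to be changed \<open>0 \<rightarrow> 1\<close>.\<close>
definition orders :: "nat \<Rightarrow> nat set \<Rightarrow> nat set \<Rightarrow> nat list set" where
  "orders n A B = {xs. distinct xs \<and> set xs = A \<union> B \<and>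
    (\<forall>i\<in>A. \<forall>j\<in>B. cyc_adj n i j \<longrightarrow> before xs i j)}"

definition falls :: "nat \<Rightarrow> nat list \<Rightarrow> nat list \<Rightarrow> nat set" where
  "falls n u v = {i. i < n \<and> u ! i = 1 \<and> v ! i = 0}"

definition flip :: "nat list \<Rightarrow> nat \<Rightarrow> nat list" where
  "flip b i = b[i := 1 - b ! i]"

fun flip_path :: "nat list \<Rightarrow> nat list \<Rightarrow> (nat list \<times> nat list) list" where
  "flip_path u [] = []"
| "flip_path u (x # xs) = (u, flip u x) # flip_path (flip u x) xs"

lemma before_Cons:
  "before (x # xs) y z \<longleftrightarrow> y = x \<and> z \<in> set xs \<or> before xs y z"
proof
  assume "before (x # xs) y z"
  then obtain a b where ab: "a < b" "b < Suc (length xs)" "(x # xs) ! a = y" "(x # xs) ! b = z"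
    by (auto simp: before_def)
  then obtain b' where b': "b = Suc b'"
    by (cases b) auto
  show "y = x \<and> z \<in> set xs \<or> before xs y z"
  proof (cases a)
    case 0
    with ab b' show ?thesis by auto
  next
    case (Suc a')
    with ab b' show ?thesis unfolding before_def by auto
  qed
next
  assume "y = x \<and> z \<in> set xs \<or> before xs y z"
  then show "before (x # xs) y z"
  proof
    assume "y = x \<and> z \<in> set xs"
    then obtain b where "b < length xs" "xs ! b = z" "y = x"
      by (auto simp: in_set_conv_nth)
    then show ?thesis
      unfolding before_def by (intro exI[of _ 0] exI[of _ "Suc b"]) auto
  next
    assume "before xs y z"
    then obtain a b where "a < b" "b < length xs" "xs ! a = y" "xs ! b = z"
      by (auto simp: before_def)
    then show ?thesis
      unfolding before_def by (intro exI[of _ "Suc a"] exI[of _ "Suc b"]) auto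
  qed
qed

lemma before_append:
  assumes "x \<in> set xs" "y \<in> set ys"
  shows "before (xs @ ys) x y"
  using assms by (induction xs) (auto simp: before_Cons)

lemma before_in_set:
  assumes "before xs x y"
  shows "x \<in> set xs" "y \<in> set xs"
  using assms by (auto simp: before_def)

lemma before_take:
  assumes "distinct xs" "before xs x y" "y \<in> set (take k xs)"
  shows "x \<in> set (take k xs)"
proof -
  obtain a b where ab: "a < b" "b < length xs" "xs ! a = x" "xs ! b = y"
    using assms(2) by (auto simp: before_def)
  obtain c where c: "c < k" "c < length xs" "xs ! c = y"
    using assms(3) by (auto simp: in_set_conv_nth)
  have "c = b"
    using assms(1) ab c nth_eq_iff_index_eq by blast
  then show ?thesis
    using ab c by (auto simp: in_set_conv_nth intro!: exI[of _ a])
qed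

subsection \<open>Walks in the Lucas cube\<close>

lemma mem_lucas_strings_iff:
  assumes "n \<ge> 1"
  shows "b \<in> lucas_strings n \<longleftrightarrow>
    length b = n \<and> (\<forall>i<n. b ! i = 0 \<or> b ! i = 1) \<and>
    (\<forall>i<n. b ! i = 0 \<or> b ! (Suc i mod n) = 0)"
proof -
  have "(\<forall>i<n. b ! i = 0 \<or> b ! (Suc i mod n) = 0) \<longleftrightarrow>
    (\<forall>i. i + 1 < n \<longrightarrow> b ! i * b ! (i + 1) = 0) \<and> b ! 0 * b ! (n - 1) = 0" (is "?L \<longleftrightarrow> ?R")
  proof
    assume L: ?L
    have "b ! i * b ! (i + 1) = 0" if "i + 1 < n" for i
      using L[rule_format, of i] that by auto
    moreover have "b ! 0 * b ! (n - 1) = 0"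
      using L[rule_format, of "n - 1"] assms by auto
    ultimately show ?R by blast
  next
    assume R: ?R
    show ?L
    proof (intro allI impI)
      fix i assume "i < n"
      then consider "i + 1 < n" | "i = n - 1" by linarith
      then show "b ! i = 0 \<or> b ! (Suc i mod n) = 0"
        using R assms by cases auto
    qed
  qed
  moreover have "set b \<subseteq> {0, 1} \<longleftrightarrow> (\<forall>i<length b. b ! i = 0 \<or> b ! i = 1)"
    by (auto simp: set_conv_nth)
  ultimately show ?thesis
    by (auto simp: lucas_strings_def binary_strings_def)
qed

lemma lucas_nth:
  assumes "b \<in> lucas_strings n" "i < n"
  shows "b ! i = 0 \<or> b ! i = 1"
  using assms by (subst (asm) mem_lucas_strings_iff) auto

lemma lucas_cyc_adj:
  assumes "b \<in> lucas_strings n" "i < n" "j < n" "cyc_adj n i j"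
  shows "b ! i = 0 \<or> b ! j = 0"
  using assms by (subst (asm) mem_lucas_strings_iff) (auto simp: cyc_adj_def)

lemma length_lucas: "b \<in> lucas_strings n \<Longrightarrow> length b = n"
  by (simp add: lucas_strings_def binary_strings_def)

lemma length_flip [simp]: "length (flip b i) = length b"
  by (simp add: flip_def)

lemma flip_nth: "i < length b \<Longrightarrow> flip b x ! i = (if i = x then 1 - b ! i else b ! i)"
  by (auto simp: flip_def nth_list_update)

lemma length_foldl_flip [simp]: "length (foldl flip b xs) = length b"
  by (induction xs arbitrary: b) auto

lemma length_flip_path [simp]: "length (flip_path u xs) = length xs"
  by (induction xs arbitrary: u) auto

lemma foldl_flip_nth_notin:
  assumes "i \<notin> set xs"
  shows "foldl flip u xs ! i = u ! i"
  using assms by (induction xs arbitrary: u) (auto simp: flip_def)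

lemma foldl_flip_nth_in:
  assumes "distinct xs" "i \<in> set xs" "i < length u"
  shows "foldl flip u xs ! i = 1 - u ! i"
  using assms
proof (induction xs arbitrary: u)
  case (Cons x xs)
  then show ?case
    by (cases "i = x") (auto simp: flip_nth foldl_flip_nth_notin)
qed simp

lemma arc_lucas_cube_iff:
  "(b, c) \<in> arcs (lucas_cube n) \<longleftrightarrow>
    b \<in> lucas_strings n \<and> c \<in> lucas_strings n \<and> (\<exists>i<n. c = flip b i)"
proof -
  have "card {i. i < n \<and> b ! i \<noteq> c ! i} = 1 \<longleftrightarrow> (\<exists>i<n. c = flip b i)"
    if bc: "b \<in> lucas_strings n" "c \<in> lucas_strings n"
  proof
    assume "card {i. i < n \<and> b ! i \<noteq> c ! i} = 1"
    then obtain i where i: "{i. i < n \<and> b ! i \<noteq> c ! i} = {i}"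
      by (auto simp: card_1_singleton_iff)
    have "c = flip b i"
    proof (rule nth_equalityI)
      fix j assume "j < length c"
      moreover have "i < n" "b ! i \<noteq> c ! i" "\<And>j. j < n \<Longrightarrow> j \<noteq> i \<Longrightarrow> b ! j = c ! j"
        using i by blast+
      ultimately show "c ! j = flip b i ! j"
        using bc[THEN length_lucas] bc[THEN lucas_nth, of j] by (cases "j = i") (auto simp: flip_def)
    qed (use bc in \<open>simp add: length_lucas\<close>)
    with i show "\<exists>i<n. c = flip b i" by blast
  next
    assume "\<exists>i<n. c = flip b i"
    then obtain i where "i < n" "c = flip b i" by blast
    then have "{i. i < n \<and> b ! i \<noteq> c ! i} = {i}"
      using bc(1)[THEN length_lucas] lucas_nth[OF bc(1), of i] by (auto simp: flip_def nth_list_update)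
    then show "card {i. i < n \<and> b ! i \<noteq> c ! i} = 1" by simp
  qed
  then show ?thesis
    by (auto simp: lucas_cube_def hypercube_def lucas_strings_def)
qed

lemma lucas_cube_simps [simp]:
  "verts (lucas_cube n) = lucas_strings n" "tail (lucas_cube n) = fst" "head (lucas_cube n) = snd"
  by (auto simp: lucas_cube_def hypercube_def)

lemma awalk_flip_path_iff:
  assumes "set xs \<subseteq> {..<n}"
  shows "pre_digraph.awalk (lucas_cube n) u (flip_path u xs) v \<longleftrightarrow>
    (\<forall>k\<le>length xs. foldl flip u (take k xs) \<in> lucas_strings n) \<and> v = foldl flip u xs"
proof -
  interpret graph "lucas_cube n" by (rule graph_lucas_cube)
  show ?thesis
    using assms
  proof (induction xs arbitrary: u)
    case Nil
    then show ?case by (auto simp: awalk_Nil_iff)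
  next
    case (Cons x xs)
    have "(\<forall>k\<le>length (x # xs). foldl flip u (take k (x # xs)) \<in> lucas_strings n) \<longleftrightarrow>
      u \<in> lucas_strings n \<and> (\<forall>k\<le>length xs. foldl flip (flip u x) (take k xs) \<in> lucas_strings n)"
      (is "?L \<longleftrightarrow> ?R")
    proof
      assume L: ?L
      show ?R
        using L[rule_format, of 0] L[rule_format, of "Suc _"] by auto
    next
      assume R: ?R
      show ?L
      proof (intro allI impI)
        fix k assume "k \<le> length (x # xs)"
        with R show "foldl flip u (take k (x # xs)) \<in> lucas_strings n" by (cases k) auto
      qed
    qed
    moreover have "flip u x \<in> lucas_strings n"
      if "\<forall>k\<le>length xs. foldl flip (flip u x) (take k xs) \<in> lucas_strings n"
      using that[rule_format, of 0] by simp
    ultimately show ?case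
      using Cons by (auto simp: awalk_Cons_iff arc_lucas_cube_iff)
  qed
qed

lemma awalk_is_flip_path:
  assumes "pre_digraph.awalk (lucas_cube n) u p v"
  shows "\<exists>xs. set xs \<subseteq> {..<n} \<and> p = flip_path u xs"
proof -
  interpret graph "lucas_cube n" by (rule graph_lucas_cube)
  show ?thesis
    using assms
  proof (induction p arbitrary: u)
    case Nil
    show ?case by (rule exI[of _ "[]"]) simp
  next
    case (Cons e p)
    obtain i where i: "i < n" "e = (u, flip u i)" "awalk (flip u i) p v"
      using Cons.prems by (cases e) (auto simp: awalk_Cons_iff arc_lucas_cube_iff)
    from Cons.IH[OF i(3)] obtain xs where "set xs \<subseteq> {..<n}" "p = flip_path (flip u i) xs"
      by blast
    with i show ?case by (intro exI[of _ "i # xs"]) simp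
  qed
qed

lemma flip_path_inj:
  assumes "flip_path u xs = flip_path u ys" "set xs \<subseteq> {..<length u}" "set ys \<subseteq> {..<length u}"
    "\<forall>i<length u. u ! i \<noteq> 1 - u ! i"
  shows "xs = ys"
  using assms
proof (induction xs arbitrary: u ys)
  case Nil
  then show ?case by (cases ys) auto
next
  case (Cons x xs)
  obtain y ys' where ys: "ys = y # ys'" using Cons.prems by (cases ys) auto
  have "x = y"
  proof (rule ccontr)
    assume "x \<noteq> y"
    then have "flip u x ! x = 1 - u ! x" "flip u y ! x = u ! x"
      using Cons.prems by (simp_all add: flip_def)
    moreover have "flip u x = flip u y" using Cons.prems ys by simp
    ultimately show False using Cons.prems by (metis insert_subset lessThan_iff list.simps(15))
  qed
  moreover have "\<forall>i<length u. flip u x ! i \<noteq> 1 - flip u x ! i"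
    using Cons.prems by (auto simp: flip_def nth_list_update) 
  ultimately show ?case
    using Cons.prems ys Cons.IH[of "flip u x" ys'] by auto
qed

lemma binary_neq_iff_falls:
  assumes "u \<in> lucas_strings n" "v \<in> lucas_strings n"
  shows "{i. i < n \<and> u ! i \<noteq> v ! i} = falls n u v \<union> falls n v u"
  using lucas_nth[OF assms(1)] lucas_nth[OF assms(2)] by (fastforce simp: falls_def)

lemma mem_orders_iff:
  assumes n: "n \<ge> 1" and u: "u \<in> lucas_strings n" and v: "v \<in> lucas_strings n"
    and xs: "distinct xs" "set xs = falls n u v \<union> falls n v u"
  shows "xs \<in> orders n (falls n u v) (falls n v u) \<longleftrightarrow>
    (\<forall>k\<le>length xs. foldl flip u (take k xs) \<in> lucas_strings n)"
proof -
  have w: "foldl flip u (take k xs) ! i = (if i \<in> set (take k xs) then v ! i else u ! i)"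
    if "i < n" for i k
  proof (cases "i \<in> set (take k xs)")
    case True
    then have "i \<in> falls n u v \<union> falls n v u" using xs(2) in_set_takeD by fastforce
    then have "v ! i = 1 - u ! i" by (auto simp: falls_def)
    moreover have "foldl flip u (take k xs) ! i = 1 - u ! i"
      using True xs(1) that length_lucas[OF u] by (intro foldl_flip_nth_in) simp_all
    ultimately show ?thesis
      using True by simp
  qed (simp add: foldl_flip_nth_notin)
  show ?thesis
  proof (intro iffI allI impI)
    fix k assume ord: "xs \<in> orders n (falls n u v) (falls n v u)"
    let ?w = "foldl flip u (take k xs)"
    have key: "\<not> (v ! i = 1 \<and> u ! j = 1)"
      if ij: "i < n" "j < n" "cyc_adj n i j" "i \<in> set (take k xs)" "j \<notin> set (take k xs)" for i j
    proof
      assume 1: "v ! i = 1 \<and> u ! j = 1"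
      then have "v ! j = 0" "u ! i = 0"
        using lucas_cyc_adj[OF u ij(1-3)] lucas_cyc_adj[OF v ij(1-3)] by auto
      then have "j \<in> falls n u v" "i \<in> falls n v u" "cyc_adj n j i"
        using 1 ij by (auto simp: falls_def cyc_adj_def)
      then have "before xs j i"
        using ord unfolding orders_def by blast
      then show False using before_take[OF xs(1)] ij by blast
    qed
    have "?w ! i = 0 \<or> ?w ! (Suc i mod n) = 0" if "i < n" for i
    proof -
      let ?j = "Suc i mod n"
      have j: "?j < n" "cyc_adj n i ?j" "cyc_adj n ?j i" using n by (auto simp: cyc_adj_def)
      let ?T = "set (take k xs)"
      consider "i \<in> ?T" "?j \<in> ?T" | "i \<notin> ?T" "?j \<notin> ?T"
        | "i \<in> ?T" "?j \<notin> ?T" | "i \<notin> ?T" "?j \<in> ?T" by blast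
      then show ?thesis
      proof cases
        case 1
        then show ?thesis using w[OF that] w[OF j(1)] lucas_cyc_adj[OF v that j(1,2)] by simp
      next
        case 2
        then show ?thesis using w[OF that] w[OF j(1)] lucas_cyc_adj[OF u that j(1,2)] by simp
      next
        case 3
        then have "v ! i \<noteq> 1 \<or> u ! ?j \<noteq> 1" using key[OF that j(1,2)] by blast
        then have "v ! i = 0 \<or> u ! ?j = 0" using lucas_nth[OF v that] lucas_nth[OF u j(1)] by auto
        with 3 show ?thesis using w[OF that] w[OF j(1)] by simp
      next
        case 4
        then have "v ! ?j \<noteq> 1 \<or> u ! i \<noteq> 1" using key[OF j(1) that j(3)] by blast
        then have "v ! ?j = 0 \<or> u ! i = 0" using lucas_nth[OF v j(1)] lucas_nth[OF u that] by auto
        with 4 show ?thesis using w[OF that, of k] w[OF j(1), of k] by auto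
      qed
    qed
    moreover have "?w ! i = 0 \<or> ?w ! i = 1" if "i < n" for i
      using w[OF that, of k] lucas_nth[OF u that] lucas_nth[OF v that] by auto
    ultimately show "?w \<in> lucas_strings n"
      using n length_lucas[OF u] by (simp add: mem_lucas_strings_iff)
  next
    assume L: "\<forall>k\<le>length xs. foldl flip u (take k xs) \<in> lucas_strings n"
    have "before xs i j" if i: "i \<in> falls n u v" and j: "j \<in> falls n v u" and a: "cyc_adj n i j" for i j
    proof -
      obtain b where b: "b < length xs" "xs ! b = j"
        using j xs(2) by (metis UnI2 in_set_conv_nth)
      have ij: "i < n" "j < n" "u ! i = 1" "v ! i = 0" "u ! j = 0" "v ! j = 1"
        using i j by (auto simp: falls_def)
      let ?T = "set (take (Suc b) xs)"
      have "j \<in> ?T" using b by (auto simp: in_set_conv_nth intro!: exI[of _ b])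
      moreover have "foldl flip u (take (Suc b) xs) \<in> lucas_strings n"
        using L b by auto
      ultimately have "foldl flip u (take (Suc b) xs) ! i = 0"
        using lucas_cyc_adj[OF _ ij(1,2) a] w[OF ij(2), of "Suc b"] ij(6) by fastforce
      then have "i \<in> ?T"
        using w[OF ij(1), of "Suc b"] ij(3) by (cases "i \<in> ?T") simp_all
      then obtain c where "c < Suc b" "c < length xs" "xs ! c = i"
        by (auto simp: in_set_conv_nth)
      moreover have "c \<noteq> b" using calculation(3) b(2) ij(3,5) by force
      ultimately have "c < b \<and> b < length xs \<and> xs ! c = i \<and> xs ! b = j" using b by simp
      then show ?thesis unfolding before_def by blast
    qed
    then show "xs \<in> orders n (falls n u v) (falls n v u)"
      using xs by (simp add: orders_def)
  qed
qed

lemma orders_nonempty: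
  assumes "finite A" "finite B" "A \<inter> B = {}"
  shows "orders n A B \<noteq> {}"
proof -
  obtain as bs where "set as = A" "distinct as" "set bs = B" "distinct bs"
    using assms finite_distinct_list by metis
  then have "as @ bs \<in> orders n A B"
    using assms by (auto simp: orders_def before_append)
  then show ?thesis by blast
qed

lemma orders_awalk:
  assumes n: "n \<ge> 1" and u: "u \<in> lucas_strings n" and v: "v \<in> lucas_strings n"
    and xs: "xs \<in> orders n (falls n u v) (falls n v u)"
  shows "pre_digraph.awalk (lucas_cube n) u (flip_path u xs) v"
    and "length xs = card {i. i < n \<and> u ! i \<noteq> v ! i}"
proof -
  have D: "distinct xs" "set xs = falls n u v \<union> falls n v u"
    using xs by (auto simp: orders_def)
  then have set: "set xs = {i. i < n \<and> u ! i \<noteq> v ! i}"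
    using binary_neq_iff_falls[OF u v] by simp
  have "v = foldl flip u xs"
  proof (rule nth_equalityI)
    fix i assume "i < length v"
    then have i: "i < n" "i < length u" using u v by (auto simp: length_lucas)
    show "v ! i = foldl flip u xs ! i"
    proof (cases "i \<in> set xs")
      case True
      then have "i \<in> falls n u v \<union> falls n v u" by (simp add: D(2))
      then have "v ! i = 1 - u ! i" by (auto simp: falls_def)
      then show ?thesis
        using foldl_flip_nth_in[OF D(1) True i(2)] by simp
    next
      case False
      then have "u ! i = v ! i" using i by (simp add: set)
      then show ?thesis
        using foldl_flip_nth_notin[OF False, of u] by simp
    qed
  qed (use u v in \<open>simp add: length_lucas\<close>)
  moreover have "set xs \<subseteq> {..<n}" using set by auto
  ultimately show "pre_digraph.awalk (lucas_cube n) u (flip_path u xs) v"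
    using mem_orders_iff[OF n u v D] xs by (simp add: awalk_flip_path_iff)
  show "length xs = card {i. i < n \<and> u ! i \<noteq> v ! i}"
    using distinct_card[OF D(1)] set by simp
qed

lemma awalk_flip_pathE:
  assumes "n \<ge> 1" "pre_digraph.awalk (lucas_cube n) u p v"
  obtains xs where "p = flip_path u xs" "set xs \<subseteq> {..<n}" "{i. i < n \<and> u ! i \<noteq> v ! i} \<subseteq> set xs"
proof -
  obtain xs where xs: "set xs \<subseteq> {..<n}" "p = flip_path u xs"
    using awalk_is_flip_path[OF assms(2)] by blast
  then have "v = foldl flip u xs"
    using awalk_flip_path_iff[OF xs(1)] assms(2) by simp
  then have "i \<in> set xs" if "u ! i \<noteq> v ! i" for i
    using that foldl_flip_nth_notin[of i xs u] by (cases "i \<in> set xs") simp_all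
  then have "{i. i < n \<and> u ! i \<noteq> v ! i} \<subseteq> set xs"
    by blast
  with xs that show thesis by blast
qed

lemma card_le_length_awalk:
  assumes "n \<ge> 1" "pre_digraph.awalk (lucas_cube n) u p v"
  shows "card {i. i < n \<and> u ! i \<noteq> v ! i} \<le> length p"
proof -
  obtain xs where "p = flip_path u xs" "{i. i < n \<and> u ! i \<noteq> v ! i} \<subseteq> set xs"
    using awalk_flip_pathE[OF assms] by blast
  then have "card {i. i < n \<and> u ! i \<noteq> v ! i} \<le> card (set xs)" "length p = length xs"
    by (auto intro: card_mono)
  then show ?thesis
    using card_length[of xs] by linarith
qed

lemma graph_dist_lucas_cube:
  assumes n: "n \<ge> 1" and u: "u \<in> lucas_strings n" and v: "v \<in> lucas_strings n"
  shows "graph_dist (lucas_cube n) u v = ereal (real (card {i. i < n \<and> u ! i \<noteq> v ! i}))"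
proof -
  interpret graph "lucas_cube n" by (rule graph_lucas_cube)
  obtain xs where xs: "xs \<in> orders n (falls n u v) (falls n v u)"
  proof -
    have "finite (falls n u v)" "finite (falls n v u)" "falls n u v \<inter> falls n v u = {}"
      by (auto simp: falls_def)
    from orders_nonempty[OF this, of n] show thesis using that by auto
  qed
  note xs' = orders_awalk[OF n u v xs]
  show ?thesis
    unfolding graph_dist_eq_INF_length[OF wf_digraph_axioms]
  proof (rule antisym)
    show "(INF p\<in>{p. awalk u p v}. ereal (real (length p))) \<le> ereal (real (card {i. i < n \<and> u ! i \<noteq> v ! i}))"
      using xs' by (intro INF_lower2[of "flip_path u xs"]) auto
    show "ereal (real (card {i. i < n \<and> u ! i \<noteq> v ! i})) \<le> (INF p\<in>{p. awalk u p v}. ereal (real (length p)))"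
      by (rule INF_greatest) (use card_le_length_awalk[OF n] in auto)
  qed
qed

lemma bij_betw_orders_shortest_paths:
  assumes n: "n \<ge> 1" and u: "u \<in> lucas_strings n" and v: "v \<in> lucas_strings n"
  shows "bij_betw (flip_path u) (orders n (falls n u v) (falls n v u)) (shortest_paths (lucas_cube n) u v)"
proof -
  interpret graph "lucas_cube n" by (rule graph_lucas_cube)
  let ?D = "{i. i < n \<and> u ! i \<noteq> v ! i}"
  let ?O = "orders n (falls n u v) (falls n v u)"
  have D: "?D = falls n u v \<union> falls n v u" by (rule binary_neq_iff_falls[OF u v])
  have sp: "shortest_paths (lucas_cube n) u v = {p. awalk u p v \<and> length p = card ?D}"
  proof -
    have "distinct (awalk_verts u p)" if p: "awalk u p v" "length p = card ?D" for p
    proof (rule ccontr)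
      assume "\<not> distinct (awalk_verts u p)"
      then obtain q r s w where qrs: "p = q @ r @ s" "0 < length r" "awalk u q w" "awalk w s v"
        using awalk_not_distinct_decomp[OF p(1)] by blast
      have "card ?D \<le> length (q @ s)"
        using card_le_length_awalk[OF n awalk_appendI[OF qrs(3,4)]] .
      moreover have "length p = length q + length r + length s"
        by (simp add: qrs(1))
      ultimately show False using p(2) qrs(2) by simp
    qed
    then show ?thesis
      unfolding shortest_paths_def graph_dist_lucas_cube[OF n u v] apath_def by auto
  qed
  have "inj_on (flip_path u) ?O"
  proof (rule inj_onI)
    fix xs ys assume *: "xs \<in> ?O" "ys \<in> ?O" "flip_path u xs = flip_path u ys"
    have "\<forall>i<length u. u ! i \<noteq> 1 - u ! i"
    proof (intro allI impI)
      fix i assume "i < length u"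
      then show "u ! i \<noteq> 1 - u ! i"
        using lucas_nth[OF u, of i] length_lucas[OF u] by auto
    qed
    then show "xs = ys"
      using * length_lucas[OF u] D by (intro flip_path_inj[of u]) (auto simp: orders_def)
  qed
  moreover have "flip_path u ` ?O = shortest_paths (lucas_cube n) u v"
  proof
    show "flip_path u ` ?O \<subseteq> shortest_paths (lucas_cube n) u v"
      using orders_awalk[OF n u v] by (auto simp: sp)
  next
    show "shortest_paths (lucas_cube n) u v \<subseteq> flip_path u ` ?O"
    proof
      fix p assume "p \<in> shortest_paths (lucas_cube n) u v"
      then have p: "awalk u p v" "length p = card ?D" by (auto simp: sp)
      then obtain xs where xs: "p = flip_path u xs" "set xs \<subseteq> {..<n}" "?D \<subseteq> set xs"
        using awalk_flip_pathE[OF n p(1)] by blast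
      have "card (set xs) \<le> card ?D"
        using p xs card_length[of xs] by simp
      then have "?D = set xs"
        using xs by (intro card_seteq) auto
      moreover have "distinct xs"
        using p xs calculation by (intro card_distinct) simp
      moreover have "\<forall>k\<le>length xs. foldl flip u (take k xs) \<in> lucas_strings n"
        using p xs awalk_flip_path_iff by simp
      ultimately have "xs \<in> ?O"
        using mem_orders_iff[OF n u v] D by simp
      then show "p \<in> flip_path u ` ?O" using xs by blast
    qed
  qed
  ultimately show ?thesis by (simp add: bij_betw_def)
qed

subsection \<open>Alternating permutations\<close>

lemma card_alternating_lists:
  assumes g: "bij_betw g {1..m} D"
  shows "card {xs. distinct xs \<and> set xs = D \<and>
    (\<forall>k\<in>{1..<m}. if odd k then before xs (g (k + 1)) (g k) else before xs (g k) (g (k + 1)))}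
    = euler_number m" (is "card ?X = _")
proof -
  let ?S = "{\<sigma>. \<sigma> permutes {1..m} \<and> alternating m \<sigma>}"
  define \<Phi> where "\<Phi> \<sigma> = map (\<lambda>t. g (inv \<sigma> (Suc t))) [0..<m]" for \<sigma> :: "nat \<Rightarrow> nat"
  have g_eq: "g a = g b \<longleftrightarrow> a = b" if "a \<in> {1..m}" "b \<in> {1..m}" for a b
    using bij_betw_imp_inj_on[OF g] that by (rule inj_on_eq_iff)
  have inv_in: "inv \<sigma> (Suc t) \<in> {1..m}" if "\<sigma> permutes {1..m}" "t < m" for \<sigma> t
    using permutes_in_image[OF permutes_inv[OF that(1)], of "Suc t"] that(2) by simp
  have before_\<Phi>: "before (\<Phi> \<sigma>) (g a) (g b) \<longleftrightarrow> \<sigma> a < \<sigma> b"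
    if \<sigma>: "\<sigma> permutes {1..m}" and ab: "a \<in> {1..m}" "b \<in> {1..m}" for \<sigma> a b
  proof -
    have nth: "\<Phi> \<sigma> ! c = g x \<longleftrightarrow> Suc c = \<sigma> x" if "c < m" "x \<in> {1..m}" for c x
    proof -
      have "\<Phi> \<sigma> ! c = g x \<longleftrightarrow> inv \<sigma> (Suc c) = x"
        using that g_eq[OF inv_in[OF \<sigma> that(1)] that(2)] by (simp add: \<Phi>_def)
      then show ?thesis
        using permutes_inv_eq[OF \<sigma>, of "Suc c" x] by auto
    qed
    have "\<sigma> a \<in> {1..m}" "\<sigma> b \<in> {1..m}"
      using \<sigma> ab by (simp_all only: permutes_in_image)
    moreover have "\<exists>c<m. x = Suc c" if "x \<in> {1..m}" for x
      using that by (intro exI[of _ "x - 1"]) auto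
    ultimately obtain c d where cd: "\<sigma> a = Suc c" "\<sigma> b = Suc d" "c < m" "d < m"
      by blast
    have "length (\<Phi> \<sigma>) = m" by (simp add: \<Phi>_def)
    show ?thesis
    proof
      assume "before (\<Phi> \<sigma>) (g a) (g b)"
      then obtain c' d' where "c' < d'" "d' < m" "\<Phi> \<sigma> ! c' = g a" "\<Phi> \<sigma> ! d' = g b"
        using \<open>length (\<Phi> \<sigma>) = m\<close> unfolding before_def by auto
      then show "\<sigma> a < \<sigma> b"
        using nth[of c' a] nth[of d' b] ab by auto
    next
      assume "\<sigma> a < \<sigma> b"
      then show "before (\<Phi> \<sigma>) (g a) (g b)"
        unfolding before_def using cd nth[OF cd(3) ab(1)] nth[OF cd(4) ab(2)] \<open>length (\<Phi> \<sigma>) = m\<close>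
        by (intro exI[of _ c] exI[of _ d]) simp
    qed
  qed
  have alt: "(\<forall>k\<in>{1..<m}. if odd k then before (\<Phi> \<sigma>) (g (k + 1)) (g k)
      else before (\<Phi> \<sigma>) (g k) (g (k + 1))) \<longleftrightarrow> alternating m \<sigma>" if \<sigma>: "\<sigma> permutes {1..m}" for \<sigma>
    unfolding alternating_def by (intro ball_cong refl) (auto simp: before_\<Phi>[OF \<sigma>])
  have "bij_betw \<Phi> ?S ?X"
  proof (rule bij_betwI')
    fix \<sigma> \<tau> assume "\<sigma> \<in> ?S" "\<tau> \<in> ?S"
    then have st: "\<sigma> permutes {1..m}" "\<tau> permutes {1..m}" by auto
    show "\<Phi> \<sigma> = \<Phi> \<tau> \<longleftrightarrow> \<sigma> = \<tau>"
    proof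
      assume eq: "\<Phi> \<sigma> = \<Phi> \<tau>"
      have "inv \<sigma> = inv \<tau>"
      proof
        fix s
        show "inv \<sigma> s = inv \<tau> s"
        proof (cases "s \<in> {1..m}")
          case True
          then obtain t where t: "s = Suc t" "t < m" by (cases s) auto
          have "\<Phi> \<sigma> ! t = \<Phi> \<tau> ! t" using eq by simp
          then show ?thesis
            using t g_eq[OF inv_in[OF st(1) t(2)] inv_in[OF st(2) t(2)]] by (simp add: \<Phi>_def)
        next
          case False
          then show ?thesis
            using permutes_not_in[OF permutes_inv[OF st(1)] False]
              permutes_not_in[OF permutes_inv[OF st(2)] False] by simp
        qed
      qed
      then have "inv (inv \<sigma>) = inv (inv \<tau>)" by (rule arg_cong)
      then show "\<sigma> = \<tau>"
        by (simp only: permutes_inv_inv[OF st(1)] permutes_inv_inv[OF st(2)])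
    qed simp
  next
    fix \<sigma> assume "\<sigma> \<in> ?S"
    then have \<sigma>: "\<sigma> permutes {1..m}" "alternating m \<sigma>" by auto
    have "bij_betw (inv \<sigma>) {1..m} {1..m}"
      by (rule permutes_imp_bij[OF permutes_inv[OF \<sigma>(1)]])
    then have "bij_betw (g \<circ> inv \<sigma>) {1..m} D"
      using g by (rule bij_betw_trans)
    have "bij_betw Suc {0..<m} {1..m}"
      by (rule bij_betwI[where g = "\<lambda>t. t - 1"]) auto
    then have "bij_betw (g \<circ> inv \<sigma> \<circ> Suc) {0..<m} D"
      using \<open>bij_betw (g \<circ> inv \<sigma>) {1..m} D\<close> by (rule bij_betw_trans)
    then have "distinct (\<Phi> \<sigma>)" "set (\<Phi> \<sigma>) = D"
      by (simp_all add: \<Phi>_def distinct_map bij_betw_def inj_on_def image_comp comp_def)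
    then show "\<Phi> \<sigma> \<in> ?X"
      using alt[OF \<sigma>(1)] \<sigma>(2) by simp
  next
    fix xs assume xs: "xs \<in> ?X"
    then have "distinct xs" "set xs = D" by simp_all
    then have len: "length xs = m"
      using distinct_card[of xs] bij_betw_same_card[OF g] by simp
    define h where "h t = the_inv_into {1..m} g (xs ! (t - 1))" for t
    define \<tau> where "\<tau> t = (if t \<in> {1..m} then h t else t)" for t
    have "bij_betw (\<lambda>t. t - 1) {1..m} {..<m}"
      by (rule bij_betwI[where g = Suc]) auto
    moreover have "bij_betw (\<lambda>i. xs ! i) {..<m} D"
      using \<open>distinct xs\<close> \<open>set xs = D\<close> len by (intro bij_betw_nth) simp_all
    ultimately have "bij_betw ((\<lambda>i. xs ! i) \<circ> (\<lambda>t. t - 1)) {1..m} D"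
      by (rule bij_betw_trans)
    then have "bij_betw (the_inv_into {1..m} g \<circ> ((\<lambda>i. xs ! i) \<circ> (\<lambda>t. t - 1))) {1..m} {1..m}"
      using bij_betw_the_inv_into[OF g] by (rule bij_betw_trans)
    then have "bij_betw \<tau> {1..m} {1..m}"
      by (rule bij_betw_cong[THEN iffD1, rotated]) (simp add: \<tau>_def h_def)
    then have \<tau>: "\<tau> permutes {1..m}"
      by (rule bij_imp_permutes) (auto simp: \<tau>_def)
    have "\<Phi> (inv \<tau>) = xs"
    proof (rule nth_equalityI)
      fix i assume "i < length (\<Phi> (inv \<tau>))"
      then have i: "i < m" by (simp add: \<Phi>_def)
      then have "\<Phi> (inv \<tau>) ! i = g (\<tau> (Suc i))"
        by (simp add: \<Phi>_def permutes_inv_inv[OF \<tau>])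
      also have "\<dots> = xs ! i"
      proof -
        have "xs ! i \<in> D" using \<open>set xs = D\<close> i len nth_mem[of i xs] by blast
        then have "g (the_inv_into {1..m} g (xs ! i)) = xs ! i"
          using f_the_inv_into_f_bij_betw[OF g] by blast
        then show ?thesis using i by (simp add: \<tau>_def h_def)
      qed
      finally show "\<Phi> (inv \<tau>) ! i = xs ! i" .
    qed (simp add: \<Phi>_def len)
    moreover have "inv \<tau> permutes {1..m}" by (rule permutes_inv[OF \<tau>])
    moreover from this have "alternating m (inv \<tau>)"
      using iffD1[OF alt[OF permutes_inv[OF \<tau>]]] xs unfolding \<open>\<Phi> (inv \<tau>) = xs\<close> mem_Collect_eq by blast
    ultimately show "\<exists>\<sigma>\<in>?S. xs = \<Phi> \<sigma>"
      by blast
  qed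
  then show ?thesis
    by (simp add: euler_number_def bij_betw_same_card)
qed

lemma card_alternating_lists_reverse:
  assumes g: "bij_betw g {1..m} D" and "even m"
  shows "card {xs. distinct xs \<and> set xs = D \<and>
    (\<forall>k\<in>{1..<m}. if odd k then before xs (g k) (g (k + 1)) else before xs (g (k + 1)) (g k))}
    = euler_number m"
proof -
  let ?g = "\<lambda>k. g (m + 1 - k)"
  let ?P = "\<lambda>g xs k. if odd k then before xs (g (k + 1)) (g k) else before xs (g k) (g (k + 1))"
  let ?Q = "\<lambda>xs k. if odd k then before xs (g k) (g (k + 1)) else before xs (g (k + 1)) (g k)"
  have "bij_betw (\<lambda>k. m + 1 - k) {1..m} {1..m}"
    by (rule bij_betwI[where g = "\<lambda>k. m + 1 - k"]) auto
  from bij_betw_trans[OF this g] have "bij_betw ?g {1..m} D"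
    by (simp add: comp_def)
  note card_alternating_lists[OF this]
  moreover have "(\<forall>k\<in>{1..<m}. ?P ?g xs k) \<longleftrightarrow> (\<forall>k\<in>{1..<m}. ?Q xs k)" for xs
  proof -
    have *: "?P ?g xs k \<longleftrightarrow> ?Q xs (m - k)" if "k \<in> {1..<m}" for k
    proof -
      have "m + 1 - k = m - k + 1" "m + 1 - (k + 1) = m - k" "odd (m - k) \<longleftrightarrow> odd k"
        using that \<open>even m\<close> by auto
      then show ?thesis by (simp only: refl)
    qed
    have m: "m - k \<in> {1..<m}" "m - (m - k) = k" if "k \<in> {1..<m}" for k
      using that by auto
    show ?thesis
    proof (intro iffI ballI)
      fix k assume k: "k \<in> {1..<m}" and "\<forall>k\<in>{1..<m}. ?P ?g xs k"
      from this(2) m(1)[OF k] have "?P ?g xs (m - k)" by (rule bspec)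
      then have "?Q xs (m - (m - k))" using *[OF m(1)[OF k]] by (rule iffD1[rotated])
      then show "?Q xs k" unfolding m(2)[OF k] .
    next
      fix k assume k: "k \<in> {1..<m}" and "\<forall>k\<in>{1..<m}. ?Q xs k"
      from this(2) m(1)[OF k] have "?Q xs (m - k)" by (rule bspec)
      then show "?P ?g xs k" using *[OF k] by (rule iffD2[rotated])
    qed
  qed
  ultimately show ?thesis by (simp only:)
qed

subsection \<open>Orders of flips along a path\<close>

lemma bij_betw_cyclic_shift:
  fixes z n :: nat
  assumes "z < n"
  shows "bij_betw (\<lambda>k. (z + k) mod n) {1..n - 1} ({..<n} - {z})"
proof (rule bij_betw_imageI)
  have eq: "(z + k) mod n = (if z + k < n then z + k else z + k - n)" if "k \<in> {1..n - 1}" for k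
  proof (cases "z + k < n")
    case False
    moreover from this have "(z + k) mod n = (z + k - n) mod n" by (intro le_mod_geq) simp
    moreover have "z + k - n < n" using assms that by simp linarith
    ultimately show ?thesis by simp
  qed simp
  show inj: "inj_on (\<lambda>k. (z + k) mod n) {1..n - 1}"
  proof (rule inj_onI)
    fix k l assume kl: "k \<in> {1..n - 1}" "l \<in> {1..n - 1}" "(z + k) mod n = (z + l) mod n"
    have "(if z + k < n then z + k else z + k - n) = (if z + l < n then z + l else z + l - n)"
      using eq[OF kl(1)] eq[OF kl(2)] kl(3) by (simp only:)
    with kl(1,2) assms show "k = l" by (simp split: if_splits; linarith)
  qed
  show "(\<lambda>k. (z + k) mod n) ` {1..n - 1} = {..<n} - {z}"
  proof (rule card_seteq)
    show "(\<lambda>k. (z + k) mod n) ` {1..n - 1} \<subseteq> {..<n} - {z}"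
    proof (rule image_subsetI)
      fix k assume k: "k \<in> {1..n - 1}"
      then have "(z + k) mod n \<noteq> z"
        unfolding eq[OF k] using assms by (cases "z + k < n") auto
      then show "(z + k) mod n \<in> {..<n} - {z}"
        using assms by simp
    qed
    have "card ({..<n} - {z}) = n - 1" using assms by simp
    then show "card ({..<n} - {z}) \<le> card ((\<lambda>k. (z + k) mod n) ` {1..n - 1})"
      unfolding card_image[OF inj] by simp
  qed simp
qed

text \<open>\<open>s\<close> tells whether the path that starts behind \<open>z\<close> begins with an element of \<open>B\<close>.\<close>
lemma orders_path:
  assumes z: "z < n" and AB: "A \<union> B = {..<n} - {z}" "A \<inter> B = {}"
    and alt: "\<And>k. k \<in> {1..n - 1} \<Longrightarrow> (z + k) mod n \<in> B \<longleftrightarrow> (odd k \<longleftrightarrow> s)"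
  shows "orders n A B = {xs. distinct xs \<and> set xs = {..<n} - {z} \<and>
    (\<forall>k\<in>{1..<n - 1}. if odd k \<longleftrightarrow> s then before xs ((z + (k + 1)) mod n) ((z + k) mod n)
      else before xs ((z + k) mod n) ((z + (k + 1)) mod n))}"
proof -
  let ?g = "\<lambda>k. (z + k) mod n"
  note g = bij_betw_cyclic_shift[OF z]
  have gA: "?g k \<in> A \<longleftrightarrow> (odd k \<longleftrightarrow> \<not> s)" if "k \<in> {1..n - 1}" for k
  proof -
    have "?g k \<in> A \<union> B" unfolding AB(1) using bij_betwE[OF g] that by blast
    then have "?g k \<in> A \<longleftrightarrow> ?g k \<notin> B" using AB(2) by blast
    then show ?thesis using alt[OF that] by simp
  qed
  have adj: "cyc_adj n (?g k) (?g (k + 1))" "cyc_adj n (?g (k + 1)) (?g k)" for k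
    by (simp_all add: cyc_adj_def mod_Suc_eq)
  have succ: "l = Suc k" if kl: "k \<in> {1..n - 1}" "l \<in> {1..n - 1}" "?g l = Suc (?g k) mod n" for k l
  proof (cases "Suc k < n")
    case True
    have "?g l = ?g (Suc k)" using kl(3) by (simp add: mod_Suc_eq)
    then show ?thesis
      by (rule inj_onD[OF bij_betw_imp_inj_on[OF g]]) (use kl True in auto)
  next
    case False
    then have "Suc k = n" using kl(1) by auto
    have "?g l = (z + Suc k) mod n" using kl(3) by (simp add: mod_Suc_eq)
    also have "\<dots> = z" using z by (simp add: \<open>Suc k = n\<close>)
    finally have "?g l = z" .
    moreover have "?g l \<in> {..<n} - {z}" using bij_betwE[OF g] kl(2) by blast
    ultimately show ?thesis by simp
  qed
  have "(\<forall>i\<in>A. \<forall>j\<in>B. cyc_adj n i j \<longrightarrow> before xs i j) \<longleftrightarrow>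
    (\<forall>k\<in>{1..<n - 1}. if odd k \<longleftrightarrow> s then before xs (?g (k + 1)) (?g k)
      else before xs (?g k) (?g (k + 1)))" (is "?L \<longleftrightarrow> ?R") for xs
  proof
    assume L: ?L
    show ?R
    proof
      fix k assume "k \<in> {1..<n - 1}"
      then have k: "k \<in> {1..n - 1}" "k + 1 \<in> {1..n - 1}" by auto
      show "if odd k \<longleftrightarrow> s then before xs (?g (k + 1)) (?g k) else before xs (?g k) (?g (k + 1))"
      proof (cases "odd k \<longleftrightarrow> s")
        case True
        have "?g k \<in> B" "?g (k + 1) \<in> A"
          unfolding alt[OF k(1)] gA[OF k(2)] using True by auto
        then have "before xs (?g (k + 1)) (?g k)" using L adj(2) by blast
        with True show ?thesis by simp
      next
        case False
        have "?g k \<in> A" "?g (k + 1) \<in> B"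
          unfolding alt[OF k(2)] gA[OF k(1)] using False by auto
        then have "before xs (?g k) (?g (k + 1))" using L adj(1) by blast
        with False show ?thesis by (simp only: if_False)
      qed
    qed
  next
    assume R: ?R
    show ?L
    proof (intro ballI impI)
      fix i j assume ij: "i \<in> A" "j \<in> B" and a: "cyc_adj n i j"
      then have "i \<in> {..<n} - {z}" "j \<in> {..<n} - {z}" using AB by auto
      then obtain k l where kl: "k \<in> {1..n - 1}" "i = ?g k" "l \<in> {1..n - 1}" "j = ?g l"
        unfolding bij_betw_imp_surj_on[OF g, symmetric] by blast
      have par: "odd k \<longleftrightarrow> \<not> s" "odd l \<longleftrightarrow> s"
        using gA[OF kl(1)] alt[OF kl(3)] ij by (simp_all add: kl(2,4))
      from a consider "l = Suc k" | "k = Suc l"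
        unfolding cyc_adj_def kl(2,4) using succ[OF kl(1,3)] succ[OF kl(3,1)] by blast
      then show "before xs i j"
      proof cases
        case 1
        then have k: "k \<in> {1..<n - 1}" "\<not> (odd k \<longleftrightarrow> s)" using kl par by auto
        have "before xs (?g k) (?g (k + 1))" using bspec[OF R k(1)] unfolding if_not_P[OF k(2)] .
        with 1 kl show ?thesis by simp
      next
        case 2
        then have l: "l \<in> {1..<n - 1}" "odd l \<longleftrightarrow> s" using kl par by auto
        have "before xs (?g (l + 1)) (?g l)" using bspec[OF R l(1)] unfolding if_P[OF l(2)] .
        with 2 kl show ?thesis by simp
      qed
    qed
  qed
  then show ?thesis
    unfolding orders_def AB(1) by auto
qed

lemma card_orders_path:
  assumes "z < n" "A \<union> B = {..<n} - {z}" "A \<inter> B = {}"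
    and "\<And>k. k \<in> {1..n - 1} \<Longrightarrow> (z + k) mod n \<in> B \<longleftrightarrow> (odd k \<longleftrightarrow> s)"
    and "s \<or> odd n"
  shows "card (orders n A B) = euler_number (n - 1)"
proof (cases s)
  case True
  then show ?thesis
    using card_alternating_lists[OF bij_betw_cyclic_shift[OF assms(1)]]
    by (subst orders_path[OF assms(1-4)]) simp_all
next
  case False
  then have "even (n - 1)" using assms(5) by simp
  have "orders n A B = {xs. distinct xs \<and> set xs = {..<n} - {z} \<and>
    (\<forall>k\<in>{1..<n - 1}. if odd k then before xs ((z + k) mod n) ((z + (k + 1)) mod n)
      else before xs ((z + (k + 1)) mod n) ((z + k) mod n))}"
    by (subst orders_path[OF assms(1-4)], assumption)
      (intro Collect_cong conj_cong ball_cong refl, simp add: False)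
  then show ?thesis
    using card_alternating_lists_reverse[OF bij_betw_cyclic_shift[OF assms(1)] \<open>even (n - 1)\<close>]
    by simp
qed

lemma alternating_pred_iff_parity:
  assumes "\<And>k. k \<in> {a..<b} \<Longrightarrow> P (Suc k) \<longleftrightarrow> \<not> P k" "a \<le> k" "k \<le> (b::nat)"
  shows "P k \<longleftrightarrow> (even (k - a) \<longleftrightarrow> P a)"
  using assms(2,3)
proof (induction k rule: dec_induct)
  case (step k)
  then show ?case using assms(1)[of k] by (auto simp: Suc_diff_le)
qed simp

lemma orders_Cons_decomp:
  assumes "A \<inter> B = {}" "A \<noteq> {}" and nb: "\<And>j. j \<in> B \<Longrightarrow> \<exists>i\<in>A. cyc_adj n i j"
  shows "orders n A B = (\<Union>p\<in>A. (#) p ` orders n (A - {p}) B)"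
proof (intro equalityI subsetI)
  fix xs assume xs: "xs \<in> orders n A B"
  then have "xs \<noteq> []" using assms(2) by (auto simp: orders_def)
  then obtain p ys where p: "xs = p # ys" by (cases xs) auto
  have d: "p \<notin> set ys" "distinct ys" and set: "insert p (set ys) = A \<union> B"
    and o: "\<And>i j. i \<in> A \<Longrightarrow> j \<in> B \<Longrightarrow> cyc_adj n i j \<Longrightarrow> before (p # ys) i j"
    using xs by (simp_all add: p orders_def)
  have "p \<notin> B"
  proof
    assume "p \<in> B"
    with nb o obtain i where "before (p # ys) i p" by blast
    then show False using d before_in_set(2)[of ys i p] by (auto simp: before_Cons)
  qed
  then have "p \<in> A" using set by blast
  moreover have "ys \<in> orders n (A - {p}) B"
  proof -
    have "set ys = insert p (set ys) - {p}" using d(1) by simp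
    also have "\<dots> = (A - {p}) \<union> B" unfolding set using \<open>p \<notin> B\<close> by blast
    finally have "set ys = (A - {p}) \<union> B" .
    moreover have "before ys i j" if "i \<in> A - {p}" "j \<in> B" "cyc_adj n i j" for i j
      using o[of i j] that by (simp add: before_Cons)
    ultimately show ?thesis using d(2) by (simp add: orders_def)
  qed
  ultimately show "xs \<in> (\<Union>p\<in>A. (#) p ` orders n (A - {p}) B)"
    using p by blast
next
  fix xs assume "xs \<in> (\<Union>p\<in>A. (#) p ` orders n (A - {p}) B)"
  then obtain p ys where "p \<in> A" "xs = p # ys" "ys \<in> orders n (A - {p}) B" by blast
  then have set: "set ys = (A - {p}) \<union> B" and "distinct ys"
    and o: "\<And>i j. i \<in> A - {p} \<Longrightarrow> j \<in> B \<Longrightarrow> cyc_adj n i j \<Longrightarrow> before ys i j"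
    by (simp_all add: orders_def)
  have "p \<notin> set ys" "insert p (set ys) = A \<union> B"
    unfolding set using assms(1) \<open>p \<in> A\<close> by blast+
  moreover have "before (p # ys) i j" if "i \<in> A" "j \<in> B" "cyc_adj n i j" for i j
    using o[of i j] that set by (cases "i = p") (simp_all add: before_Cons)
  ultimately show "xs \<in> orders n A B"
    using \<open>distinct ys\<close> by (simp add: \<open>xs = p # ys\<close> orders_def)
qed

lemma finite_orders: "finite A \<Longrightarrow> finite B \<Longrightarrow> finite (orders n A B)"
proof -
  assume "finite A" "finite B"
  then have "finite {xs. set xs \<subseteq> A \<union> B \<and> length xs \<le> card (A \<union> B)}"
    by (intro finite_lists_length_le) simp
  moreover have "orders n A B \<subseteq> {xs. set xs \<subseteq> A \<union> B \<and> length xs \<le> card (A \<union> B)}"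
    by (auto simp: orders_def dest: distinct_card)
  ultimately show ?thesis by (rule rev_finite_subset)
qed

lemma card_orders_Cons:
  assumes "finite A" "finite B" "A \<inter> B = {}" "A \<noteq> {}"
    "\<And>j. j \<in> B \<Longrightarrow> \<exists>i\<in>A. cyc_adj n i j"
  shows "card (orders n A B) = (\<Sum>p\<in>A. card (orders n (A - {p}) B))"
proof -
  have "orders n A B = (\<Union>p\<in>A. (#) p ` orders n (A - {p}) B)"
    using assms(3-5) by (rule orders_Cons_decomp)
  also have "card \<dots> = (\<Sum>p\<in>A. card ((#) p ` orders n (A - {p}) B))"
    using assms(1,2) by (intro card_UN_disjoint) (auto intro: finite_orders)
  finally have "card (orders n A B) = (\<Sum>p\<in>A. card ((#) p ` orders n (A - {p}) B))" .
  then show ?thesis by (simp add: card_image)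
qed

subsection \<open>Diametral pairs\<close>

lemma card_falls_diametral:
  assumes n: "n \<ge> 2" and u: "u \<in> lucas_strings n" and v: "v \<in> lucas_strings n"
    and diam: "graph_dist (lucas_cube n) u v = graph_diam (lucas_cube n)"
  shows "2 * (n div 2) \<le> card (falls n u v \<union> falls n v u)"
proof -
  define a :: "nat list" where "a = map (\<lambda>i. if even i \<and> i + 1 < n then 1 else 0) [0..<n]"
  define b :: "nat list" where "b = map (\<lambda>i. if odd i then 1 else 0) [0..<n]"
  have 1: "1 \<le> n" using n by simp
  have ab: "a \<in> lucas_strings n" "b \<in> lucas_strings n"
    using n by (auto simp: a_def b_def mem_lucas_strings_iff[OF 1] mod_Suc)
  have "card {..<2 * (n div 2)} \<le> card {i. i < n \<and> a ! i \<noteq> b ! i}"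
  proof (rule card_mono)
    show "{..<2 * (n div 2)} \<subseteq> {i. i < n \<and> a ! i \<noteq> b ! i}"
    proof
      fix i assume "i \<in> {..<2 * (n div 2)}"
      then have i: "i < 2 * (n div 2)" by simp
      have "i < n" using i by linarith
      moreover have "i + 1 < n" if "even i"
        using i that by presburger
      ultimately show "i \<in> {i. i < n \<and> a ! i \<noteq> b ! i}"
        by (auto simp: a_def b_def)
    qed
  qed simp
  then have "ereal (real (2 * (n div 2))) \<le> graph_dist (lucas_cube n) a b"
    by (simp add: graph_dist_lucas_cube[OF 1 ab])
  also have "\<dots> \<le> graph_diam (lucas_cube n)"
    unfolding graph_diam_def using ab by (intro SUP_upper2[of a] SUP_upper2[of b]) simp_all
  also have "\<dots> = ereal (real (card (falls n u v \<union> falls n v u)))"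
    by (simp add: diam[symmetric] graph_dist_lucas_cube[OF 1 u v] binary_neq_iff_falls[OF u v])
  finally show ?thesis by (simp only: ereal_less_eq of_nat_le_iff)
qed

lemma falls_alternate:
  assumes "u \<in> lucas_strings n" "v \<in> lucas_strings n" "i < n"
    and "i \<in> falls n u v \<union> falls n v u" "Suc i mod n \<in> falls n u v \<union> falls n v u"
  shows "Suc i mod n \<in> falls n v u \<longleftrightarrow> i \<notin> falls n v u"
proof -
  have j: "Suc i mod n < n" "cyc_adj n i (Suc i mod n)"
    using assms(3) by (auto simp: cyc_adj_def)
  show ?thesis
    using lucas_cyc_adj[OF assms(1,3) j] lucas_cyc_adj[OF assms(2,3) j] assms(4,5)
    by (auto simp: falls_def)
qed

lemma card_eq_of_all_falls:
  assumes u: "u \<in> lucas_strings n" and v: "v \<in> lucas_strings n"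
    and all: "falls n u v \<union> falls n v u = {..<n}"
  shows "card (falls n u v) = card (falls n v u)" and "2 * card (falls n u v) = n"
proof -
  have fin: "finite (falls n a b)" for a b by (simp add: falls_def)
  have dis: "falls n u v \<inter> falls n v u = {}" by (auto simp: falls_def)
  have suc: "Suc i mod n \<in> falls n v u \<longleftrightarrow> i \<notin> falls n v u" if "i < n" for i
    using falls_alternate[OF u v that] that unfolding all by simp
  have inj: "inj_on (\<lambda>i. Suc i mod n) {..<n}"
    by (rule inj_onI) (auto simp: mod_Suc split: if_splits)
  have "falls n u v \<subseteq> {..<n}" "falls n v u \<subseteq> {..<n}" using all by blast+
  note inj' = this[THEN inj_on_subset[OF inj]]
  have mem: "i \<in> falls n u v \<longleftrightarrow> i \<notin> falls n v u" if "i < n" for i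
    using dis all that by blast
  have "(\<lambda>i. Suc i mod n) ` falls n u v \<subseteq> falls n v u"
  proof (rule image_subsetI)
    fix i assume "i \<in> falls n u v"
    then show "Suc i mod n \<in> falls n v u" using suc[of i] mem[of i] all by blast
  qed
  then have "card (falls n u v) \<le> card (falls n v u)"
    by (intro card_inj_on_le[OF inj'(1)] fin)
  moreover have "(\<lambda>i. Suc i mod n) ` falls n v u \<subseteq> falls n u v"
  proof (rule image_subsetI)
    fix i assume i: "i \<in> falls n v u"
    then have "i < n" by (simp add: falls_def)
    then have "Suc i mod n < n" by (intro mod_less_divisor) simp
    then show "Suc i mod n \<in> falls n u v" using suc[OF \<open>i < n\<close>] mem[of "Suc i mod n"] i by blast
  qed
  then have "card (falls n v u) \<le> card (falls n u v)"
    by (intro card_inj_on_le[OF inj'(2)] fin)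
  ultimately show eq: "card (falls n u v) = card (falls n v u)" by simp
  have "card (falls n u v) + card (falls n v u) = n"
    using card_Un_disjoint[OF fin fin dis] unfolding all by simp
  with eq show "2 * card (falls n u v) = n" by simp
qed

lemma cyclic_alternation:
  assumes u: "u \<in> lucas_strings n" and v: "v \<in> lucas_strings n"
    and z: "z < n" and D: "{..<n} - {z} \<subseteq> falls n u v \<union> falls n v u"
    and k: "k \<in> {1..n - 1}"
  shows "(z + k) mod n \<in> falls n v u \<longleftrightarrow> (odd k \<longleftrightarrow> Suc z mod n \<in> falls n v u)"
proof -
  let ?P = "\<lambda>k. (z + k) mod n \<in> falls n v u"
  have in_D: "(z + l) mod n \<in> falls n u v \<union> falls n v u" if "l \<in> {1..n - 1}" for l
    using bij_betwE[OF bij_betw_cyclic_shift[OF z]] that D by blast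
  have step: "?P (Suc l) \<longleftrightarrow> \<not> ?P l" if "l \<in> {1..<n - 1}" for l
  proof -
    have l: "l \<in> {1..n - 1}" "Suc l \<in> {1..n - 1}" using that by auto
    have "Suc ((z + l) mod n) mod n = (z + Suc l) mod n" by (simp add: mod_Suc_eq)
    with falls_alternate[OF u v, of "(z + l) mod n"] in_D[OF l(1)] in_D[OF l(2)] z
    show ?thesis by simp
  qed
  have "?P k \<longleftrightarrow> (even (k - 1) \<longleftrightarrow> ?P 1)"
    using alternating_pred_iff_parity[of 1 "n - 1" ?P k] step k by simp
  then show ?thesis using k by simp
qed

theorem theorem2:
  fixes n :: nat and u v :: "nat list"
  assumes "n \<ge> 2"
    and "u \<in> verts (lucas_cube n)" and "v \<in> verts (lucas_cube n)"
    and "graph_dist (lucas_cube n) u v = graph_diam (lucas_cube n)"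
  shows "real (card (shortest_paths (lucas_cube n) u v)) =
    (if even n then real n / 2 * real (euler_number (n - 1))
     else real (euler_number (n - 1)))"
proof -
  let ?A = "falls n u v" and ?B = "falls n v u"
  have u: "u \<in> lucas_strings n" and v: "v \<in> lucas_strings n" using assms(2,3) by simp_all
  have D: "2 * (n div 2) \<le> card (?A \<union> ?B)" by (rule card_falls_diametral[OF assms(1) u v assms(4)])
  have sub: "?A \<union> ?B \<subseteq> {..<n}" by (auto simp: falls_def)
  have dis: "?A \<inter> ?B = {}" by (auto simp: falls_def)
  have fin: "finite ?A" "finite ?B" by (simp_all add: falls_def)
  have "card (shortest_paths (lucas_cube n) u v) = card (orders n ?A ?B)"
    using bij_betw_orders_shortest_paths[OF _ u v] assms(1) by (simp add: bij_betw_same_card)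
  moreover have "real (card (orders n ?A ?B)) =
    (if even n then real n / 2 * real (euler_number (n - 1)) else real (euler_number (n - 1)))"
  proof (cases "even n")
    case True
    then have "card {..<n} \<le> card (?A \<union> ?B)" using D by simp
    then have all: "?A \<union> ?B = {..<n}" by (intro card_seteq sub) simp
    note card_A = card_eq_of_all_falls[OF u v all]
    have p: "card (orders n (?A - {p}) ?B) = euler_number (n - 1)" if "p \<in> ?A" for p
    proof (rule card_orders_path[where z = p and s = True])
      show z: "p < n" using that sub by blast
      show "?A - {p} \<union> ?B = {..<n} - {p}" using that dis all by blast
      show "(?A - {p}) \<inter> ?B = {}" using dis by blast
      fix k assume k: "k \<in> {1..n - 1}"
      have "{..<n} - {p} \<subseteq> ?A \<union> ?B" unfolding all by blast
      moreover have "Suc p mod n \<in> ?B"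
        using falls_alternate[OF u v z] that dis z unfolding all by auto
      ultimately show "(p + k) mod n \<in> ?B \<longleftrightarrow> (odd k \<longleftrightarrow> True)"
        using cyclic_alternation[OF u v z _ k] by simp
    qed simp
    have nb: "\<exists>i\<in>?A. cyc_adj n i j" if j: "j \<in> ?B" for j
    proof
      have "j < n" using j by (simp add: falls_def)
      then have "Suc j mod n \<in> ?A \<union> ?B" unfolding all by simp
      then show "Suc j mod n \<in> ?A"
        using falls_alternate[OF u v \<open>j < n\<close>] j by blast
      show "cyc_adj n (Suc j mod n) j" by (simp add: cyc_adj_def)
    qed
    have "?A \<noteq> {}" using card_A(2) assms(1) by auto
    then have "card (orders n ?A ?B) = (\<Sum>p\<in>?A. card (orders n (?A - {p}) ?B))"
      by (rule card_orders_Cons[OF fin dis _ nb])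
    also have "\<dots> = card ?A * euler_number (n - 1)" by (simp add: p)
    finally have "card (orders n ?A ?B) = card ?A * euler_number (n - 1)" .
    moreover have "real (card ?A) = real n / 2" using card_A(2) by linarith
    ultimately show ?thesis using True by simp
  next
    case False
    then have "?A \<union> ?B \<noteq> {..<n}" using card_eq_of_all_falls(2)[OF u v] by (metis dvd_triv_left)
    then obtain z where z: "z < n" "z \<notin> ?A \<union> ?B" using sub by blast
    then have sub': "?A \<union> ?B \<subseteq> {..<n} - {z}" using sub by blast
    have "card ({..<n} - {z}) = 2 * (n div 2)" using z(1) False by (simp add: odd_two_times_div_two_nat)
    with D have all: "?A \<union> ?B = {..<n} - {z}" by (intro card_seteq sub') simp_all
    have "card (orders n ?A ?B) = euler_number (n - 1)"
    proof (rule card_orders_path[OF z(1) all dis])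
      fix k assume k: "k \<in> {1..n - 1}"
      show "(z + k) mod n \<in> ?B \<longleftrightarrow> (odd k \<longleftrightarrow> Suc z mod n \<in> ?B)"
        by (rule cyclic_alternation[OF u v z(1) _ k]) (simp add: all)
    qed (use False in simp)
    with False show ?thesis by simp
  qed
  ultimately show ?thesis by simp
qed

end
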